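(* Let $\mathcal A$ be a commutative ring, $D$ a derivation of $\mathcal A$, $\xi$ a free variable and $0\neq P(\xi)=\sum_{i=0}^dc_i\xi^i\in\mathcal A[\xi]$. Let $f\in\mathcal A$ be such that $f^m\in\operatorname{Ker}P(D)$ for all $1\le m\le d+1$. Then for each $0\le i\le d$, $$\alpha_{d+1}\,c_i\,(Df)^{\frac12d(d+1)}f^{d+1}=0,$$ where $\alpha_{d+1}=\prod_{k=1}^dk!$.
   Context: A derivation of $\mathcal A$ is an additive map $D:\mathcal A\to\mathcal A$ with $D(ab)=D(a)b+aD(b)$ for all $a,b\in\mathcal A$. $P(D)$ is the map $a\mapsto\sum_{i=0}^dc_iD^i(a)$ from $\mathcal A$ to $\mathcal A$. *)

theory Defs
  imports "HOL-Computational_Algebra.Polynomial"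
begin

definition derivation :: "('a::comm_ring_1 \<Rightarrow> 'a) \<Rightarrow> bool" where
  "derivation D \<longleftrightarrow>
     (\<forall>a b. D (a + b) = D a + D b) \<and> (\<forall>a b. D (a * b) = D a * b + a * D b)"

text \<open>Coefficients of \<open>P\<close> beyond its degree vanish, so the sum may equally be taken up to any
  \<open>d \<ge> degree P\<close>.\<close>

definition poly_op :: "'a::comm_ring_1 poly \<Rightarrow> ('a \<Rightarrow> 'a) \<Rightarrow> 'a \<Rightarrow> 'a" where
  "poly_op P D = (\<lambda>a. \<Sum>i\<le>degree P. coeff P i * (D ^^ i) a)"

definition Ker :: "('a \<Rightarrow> 'b::zero) \<Rightarrow> 'a set" where
  "Ker T = {a. T a = 0}"

text \<open>Only the factors \<open>k < n\<close> occur. The value is a natural number, acting on an arbitrary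
  ring via \<open>of_nat\<close>, since \<open>fact\<close> is available only in characteristic zero.\<close>

definition alpha :: "nat \<Rightarrow> nat" where
  "alpha n = (\<Prod>k=1..<n. fact k)"

end

theory Submission
  imports Defs
begin

text \<open>Let \<open>ad f L\<close> be the commutator of an operator \<open>L\<close> with multiplication by \<open>f\<close>. The operator
  \<open>(ad f)^k D^i\<close> vanishes for \<open>i < k\<close> and is multiplication by \<open>k! (Df)^k\<close> for \<open>i = k\<close>.
  On the other hand, \<open>(ad f)^k P(D)\<close> applied to \<open>f\<close> only involves the values of \<open>P(D)\<close> at
  \<open>f, \<dots>, f^(k+1)\<close>, so it vanishes for \<open>k \<le> d\<close>. Hence the coefficients of \<open>P\<close> solve a homogeneous
  triangular linear system with diagonal entries \<open>k! (Df)^k f\<close>, and back substitution shows that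
  the product of these entries annihilates every coefficient.\<close>

definition ad :: "'a::comm_ring_1 \<Rightarrow> ('a \<Rightarrow> 'a) \<Rightarrow> 'a \<Rightarrow> 'a" where
  "ad f L = (\<lambda>g. L (f * g) - f * L g)"

lemma derivation_add: "derivation D \<Longrightarrow> D (a + b) = D a + D b"
  and derivation_mult: "derivation D \<Longrightarrow> D (a * b) = D a * b + a * D b"
  by (auto simp: derivation_def)

lemma derivation_0: "derivation D \<Longrightarrow> D 0 = 0"
  using derivation_add[of D 0 0] by simp

lemma derivation_diff:
  assumes "derivation D"
  shows "D (a - b) = D a - D b"
  using derivation_add[OF assms, of "a - b" b] by simp

lemma ad_pow_Suc: "(ad f ^^ Suc k) L g = (ad f ^^ k) L (f * g) - f * (ad f ^^ k) L g"
  by (simp add: ad_def)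

lemma ad_pow_sum:
  "(ad f ^^ k) (\<lambda>g. \<Sum>i\<in>A. c i * L i g) g = (\<Sum>i\<in>A. c i * (ad f ^^ k) (L i) g)"
  by (induction k arbitrary: g)
     (simp_all add: ad_pow_Suc sum_subtractf sum_distrib_left right_diff_distrib mult.left_commute
        del: funpow.simps(2))

text \<open>Each \<open>ad f\<close> raises the exponent at which \<open>L\<close> is evaluated by
  at most one.\<close>

lemma ad_pow_power_eq_0:
  assumes "\<And>j. m \<le> j \<Longrightarrow> j \<le> m + k \<Longrightarrow> L (f ^ j) = 0"
  shows "(ad f ^^ k) L (f ^ m) = 0"
  using assms
proof (induction k arbitrary: m)
  case 0
  then show ?case by simp
next
  case (Suc k)
  have "(ad f ^^ k) L (f ^ Suc m) = 0" "(ad f ^^ k) L (f ^ m) = 0"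
    by (intro Suc.IH Suc.prems; simp)+
  then show ?case by (simp add: ad_pow_Suc del: funpow.simps(2))
qed

text \<open>\<open>ad f\<close> obeys the Leibniz rule for composition of additive operators, and
  \<open>ad f D\<close> is multiplication by \<open>D f\<close>, which a further \<open>ad f\<close>
  kills. So only two terms of the iterated Leibniz formula survive.\<close>

lemma ad_pow_derivation_comp:
  assumes "derivation D"
  shows "(ad f ^^ Suc k) (\<lambda>g. D (L g)) g
    = D ((ad f ^^ Suc k) L g) + of_nat (Suc k) * D f * (ad f ^^ k) L g"
proof (induction k arbitrary: g)
  case 0
  show ?case
    by (simp add: ad_def derivation_diff[OF assms] derivation_mult[OF assms])
next
  case (Suc k)
  \<comment> \<open>The recursion read backwards, to eliminate values at \<open>f * g\<close>. The
    product rule for \<open>D (f * _)\<close> then supplies the extra \<open>D f\<close> that raises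
    the coefficient by one.\<close>
  have B: "(ad f ^^ k) L (f * g) = (ad f ^^ Suc k) L g + f * (ad f ^^ k) L g"
    by (simp add: ad_pow_Suc del: funpow.simps(2))
  show ?case
    unfolding ad_pow_Suc[of "Suc k"] Suc.IH B derivation_diff[OF assms] derivation_mult[OF assms]
    by (simp add: algebra_simps del: funpow.simps(2))
qed

lemma ad_pow_id_eq_0:
  assumes "k > 0"
  shows "(ad f ^^ k) (\<lambda>g. g) g = 0"
proof -
  have "(ad f ^^ Suc j) (\<lambda>g. g) g = 0" for j
    by (induction j arbitrary: g) (simp_all add: ad_def)
  then show ?thesis using assms gr0_implies_Suc by blast
qed

lemma ad_pow_derivation_pow:
  assumes "derivation D"
  shows "i < k \<Longrightarrow> (ad f ^^ k) (D ^^ i) g = 0"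
    and "(ad f ^^ i) (D ^^ i) g = of_nat (fact i) * D f ^ i * g"
proof -
  have D_Suc: "D ^^ Suc i = (\<lambda>g. D ((D ^^ i) g))" for i
    by (simp add: comp_def)
  show lower: "(ad f ^^ k) (D ^^ i) g = 0" if "i < k" for i k g
    using that
  proof (induction i arbitrary: k g)
    case 0
    then show ?case by (simp add: ad_pow_id_eq_0 id_def)
  next
    case (Suc i)
    then obtain j where "k = Suc j" "i < j" by (metis Suc_lessE)
    then show ?case
      using ad_pow_derivation_comp[OF assms, where f = f and k = j and L = "D ^^ i" and g = g] Suc.IH[of "Suc j" g] Suc.IH[of j g]
      by (simp only: D_Suc) (simp add: derivation_0[OF assms])
  qed
  show "(ad f ^^ i) (D ^^ i) g = of_nat (fact i) * D f ^ i * g"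
  proof (induction i)
    case 0
    show ?case by simp
  next
    case (Suc i)
    then show ?case
      using ad_pow_derivation_comp[OF assms, where f = f and k = i and L = "D ^^ i" and g = g] lower[of i "Suc i" g]
      by (simp only: D_Suc) (simp add: derivation_0[OF assms] algebra_simps)
  qed
qed

text \<open>Zero divisors rule out dividing a row by its diagonal entry; multiplying by the entries
  replaces division.\<close>

lemma triangular_system_annihilates:
  fixes c :: "nat \<Rightarrow> 'a::comm_ring_1"
  assumes upper: "\<And>k i. i < k \<Longrightarrow> k \<le> d \<Longrightarrow> E k i = 0"
    and sol: "\<And>k. k \<le> d \<Longrightarrow> (\<Sum>i\<le>d. c i * E k i) = 0"
    and "i \<le> d"
  shows "c i * (\<Prod>k\<le>d. E k k) = 0"
proof -
  \<comment> \<open>Rows are treated from the last one upwards. Using only the diagonal entries from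
    \<open>i\<close> on makes the induction work.\<close>
  have tail: "c i * (\<Prod>k=i..d. E k k) = 0" if "i \<le> d" for i
    using that
  proof (induction "d - i" arbitrary: i rule: less_induct)
    case less
    have "(\<Sum>j\<le>d. c j * E i j) = c i * E i i + (\<Sum>j\<in>{..d} - {i}. c j * E i j)"
      using less.prems by (simp add: sum.remove)
    also have "(\<Sum>j\<in>{..d} - {i}. c j * E i j) = (\<Sum>j=Suc i..d. c j * E i j)"
    proof (rule sum.mono_neutral_right)
      show "\<forall>j\<in>{..d} - {i} - {Suc i..d}. c j * E i j = 0"
      proof
        fix j
        assume "j \<in> {..d} - {i} - {Suc i..d}"
        then have "E i j = 0" using less.prems by (intro upper) auto
        then show "c j * E i j = 0" by simp
      qed
    qed auto
    finally have diag: "c i * E i i = - (\<Sum>j=Suc i..d. c j * E i j)"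
      using sol[OF less.prems] by (simp add: eq_neg_iff_add_eq_0)
    \<comment> \<open>The product contains the factors from \<open>j\<close> on, which annihilate
      \<open>c j\<close> by induction.\<close>
    have vanish: "c j * E i j * (\<Prod>k=Suc i..d. E k k) = 0" if "j \<in> {Suc i..d}" for j
    proof -
      have "{Suc i..d} = {Suc i..<j} \<union> {j..d}" using that by auto
      then have "(\<Prod>k=Suc i..d. E k k) = (\<Prod>k=Suc i..<j. E k k) * (\<Prod>k=j..d. E k k)"
        by (simp only:) (rule prod.union_disjoint; auto)
      then have "c j * E i j * (\<Prod>k=Suc i..d. E k k)
          = E i j * (\<Prod>k=Suc i..<j. E k k) * (c j * (\<Prod>k=j..d. E k k))"
        by (simp only: mult_ac)
      also have "c j * (\<Prod>k=j..d. E k k) = 0"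
        using that less.prems by (intro less.hyps) auto
      finally show ?thesis by simp
    qed
    have "c i * (\<Prod>k=i..d. E k k) = c i * E i i * (\<Prod>k=Suc i..d. E k k)"
      using less.prems by (simp add: prod.atLeast_Suc_atMost mult.assoc)
    also have "\<dots> = 0"
      using vanish by (simp add: diag sum_distrib_right)
    finally show ?case .
  qed
  have "{..d} = {..<i} \<union> {i..d}" using \<open>i \<le> d\<close> by auto
  then have "(\<Prod>k\<le>d. E k k) = (\<Prod>k<i. E k k) * (\<Prod>k=i..d. E k k)"
    by (simp only:) (rule prod.union_disjoint; auto)
  then have "c i * (\<Prod>k\<le>d. E k k) = (\<Prod>k<i. E k k) * (c i * (\<Prod>k=i..d. E k k))"
    by (simp only: mult.left_commute)
  then show ?thesis by (simp add: tail[OF \<open>i \<le> d\<close>])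
qed

lemma prod_diagonal:
  fixes a f :: "'a::comm_ring_1"
  shows "(\<Prod>k\<le>d. of_nat (fact k) * a ^ k * f)
    = of_nat (alpha (d + 1)) * a ^ (d * (d + 1) div 2) * f ^ (d + 1)"
proof (induction d)
  case 0
  show ?case by (simp add: alpha_def)
next
  case (Suc d)
  have "Suc d * (Suc d + 1) div 2 = d * (d + 1) div 2 + Suc d"
    by (simp add: algebra_simps)
  moreover have "alpha (Suc d + 1) = alpha (d + 1) * fact (Suc d)"
    by (simp add: alpha_def del: fact_Suc)
  ultimately show ?case
    using Suc.IH by (simp only: prod.atMost_Suc of_nat_mult power_add) (simp add: mult_ac)
qed

text \<open>Since \<open>c d\<close> may be zero, \<open>d\<close> only bounds the degree; the
  surplus terms have zero coefficients.\<close>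

lemma poly_op_sum_monom:
  "poly_op (\<Sum>i\<le>d. monom (c i) i) D = (\<lambda>a. \<Sum>i\<le>d. c i * (D ^^ i) a)"
proof
  fix a
  let ?P = "\<Sum>i\<le>d. monom (c i) i"
  have coeff: "coeff ?P i = (if i \<le> d then c i else 0)" for i
    by (simp add: coeff_sum if_distrib cong: if_cong)
  then have "degree ?P \<le> d" by (simp add: degree_le)
  then have "poly_op ?P D a = (\<Sum>i\<le>d. coeff ?P i * (D ^^ i) a)"
    unfolding poly_op_def by (intro sum.mono_neutral_left) (auto simp: coeff_eq_0)
  also have "\<dots> = (\<Sum>i\<le>d. c i * (D ^^ i) a)"
    by (intro sum.cong) (simp_all add: coeff)
  finally show "poly_op ?P D a = (\<Sum>i\<le>d. c i * (D ^^ i) a)" .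
qed

theorem proposition5p4:
  fixes D :: "'a::comm_ring_1 \<Rightarrow> 'a"
    and P :: "'a poly" and c :: "nat \<Rightarrow> 'a" and d :: nat and f :: 'a
  assumes "derivation D"
    and "P = (\<Sum>i\<le>d. monom (c i) i)"
    and "P \<noteq> 0"
    and "\<And>m. 1 \<le> m \<Longrightarrow> m \<le> d + 1 \<Longrightarrow> f ^ m \<in> Ker (poly_op P D)"
  shows "\<forall>i\<le>d. of_nat (alpha (d + 1)) * c i * D f ^ (d * (d + 1) div 2) * f ^ (d + 1) = 0"
proof (intro allI impI)
  fix i
  assume "i \<le> d"
  \<comment> \<open>Evaluation is at \<open>f\<close> rather than \<open>1\<close>, as nothing is
    assumed about \<open>P(D)\<close> at \<open>f ^ 0\<close>; this puts the factor \<open>f\<close>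
    into every diagonal entry.\<close>
  define E where "E k i = (ad f ^^ k) (D ^^ i) f" for k i
  have "(\<Sum>i\<le>d. c i * E k i) = 0" if "k \<le> d" for k
  proof -
    \<comment> \<open>The exponents involved run from 1 to \<open>k + 1\<close>, hence stay within
      \<open>d + 1\<close>.\<close>
    have "(ad f ^^ k) (poly_op P D) (f ^ 1) = 0"
      using assms(4) that by (intro ad_pow_power_eq_0) (auto simp: Ker_def)
    then show ?thesis
      by (simp add: E_def assms(2) poly_op_sum_monom ad_pow_sum)
  qed
  moreover have "E k i = 0" if "i < k" for k i
    using that by (simp add: E_def ad_pow_derivation_pow(1)[OF assms(1)])
  ultimately have "c i * (\<Prod>k\<le>d. E k k) = 0"
    using \<open>i \<le> d\<close> by (intro triangular_system_annihilates)
  then have "c i * (\<Prod>k\<le>d. of_nat (fact k) * D f ^ k * f) = 0"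
    by (simp add: E_def ad_pow_derivation_pow(2)[OF assms(1)])
  then show "of_nat (alpha (d + 1)) * c i * D f ^ (d * (d + 1) div 2) * f ^ (d + 1) = 0"
    unfolding prod_diagonal by (simp only: mult_ac)
qed

end
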